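(* Let $e(X)$, $e^*(X)$, $\mu_1(X)$, $\mu^*_1(X)$ be, respectively, the true propensity score, the limiting misspecified propensity score, the true conditional mean of $Y(1)$ and the limiting misspecified outcome regression for $Y(1)$, as described in the context, and let $\mu_1=E[Y(1)]$. If $$\left|E\left[\left(\frac{e(X)}{e^*(X)}-1\right)\left(\mu_1(X)-\mu^*_1(X)\right)\right]\right|<\left|\frac{E\left[\frac{e(X)}{e^*(X)}\mu_1(X)\right]}{E\left[\frac{e(X)}{e^*(X)}\right]}-\mu_1\right|,$$ then $$E\left[\left(\frac{e(X)}{e^*(X)}-1\right)\mu_1(X)\right]-\frac{\left|\operatorname{cov}\left[\frac{e(X)}{e^*(X)},\mu_1(X)\right]\right|}{E\left[\frac{e(X)}{e^*(X)}\right]}<E\left[\left(\frac{e(X)}{e^*(X)}-1\right)\mu^*_1(X)\right]$$ and $$E\left[\left(\frac{e(X)}{e^*(X)}-1\right)\mu^*_1(X)\right]<E\left[\left(\frac{e(X)}{e^*(X)}-1\right)\mu_1(X)\right]+\frac{\left|\operatorname{cov}\left[\frac{e(X)}{e^*(X)},\mu_1(X)\right]\right|}{E\left[\frac{e(X)}{e^*(X)}\right]}.$$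
   Context: $X$ is a random vector of covariates, $T\in\{0,1\}$ a binary treatment, $Y(1)$ an integrable real-valued potential outcome with $Y(1)$ conditionally independent of $T$ given $X$. $e(X)=P(T=1\mid X)$, with $\eta<e(X)<1-\eta$ a.s. for some $\eta>0$; $e^*(X)$ is a measurable function of $X$ (the probability limit of a possibly misspecified propensity score model) with $\nu<e^*(X)<1-\nu$ a.s. for some $\nu>0$. $\mu_1(X)=E(Y(1)\mid X)$; $\mu^*_1(X)$ is an integrable function of $X$ (the probability limit of a possibly misspecified outcome regression model). $\operatorname{cov}[A,B]=E[AB]-E[A]E[B]$. The two sides of the hypothesis are the absolute values of the parts of the asymptotic biases concerning $\mu_1$ of, respectively, the doubly robust estimator and the inverse probability weighting estimator with normalized weights. *)

theory Defs
  imports "HOL-Probability.Probability"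
begin

definition sigma_gen :: "'w measure \<Rightarrow> ('w \<Rightarrow> 'x) \<Rightarrow> 'x measure \<Rightarrow> 'w measure" where
  "sigma_gen M X N = vimage_algebra (space M) X N"

text \<open>
  \<open>cond_expect_given M N X Y\<close> is \<open>E(Y | X)\<close> and \<open>cond_prob_given M N X A\<close> is \<open>P(A | X)\<close>, both as
  random variables on the sample space (determined almost surely); the conditioning is on the
  sigma-algebra generated by \<open>X\<close>, a random element of \<open>N\<close>.
\<close>

definition cond_expect_given ::
  "'w measure \<Rightarrow> 'x measure \<Rightarrow> ('w \<Rightarrow> 'x) \<Rightarrow> ('w \<Rightarrow> real) \<Rightarrow> 'w \<Rightarrow> real" where
  "cond_expect_given M N X Y = real_cond_exp M (sigma_gen M X N) Y"

definition cond_prob_given ::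
  "'w measure \<Rightarrow> 'x measure \<Rightarrow> ('w \<Rightarrow> 'x) \<Rightarrow> 'w set \<Rightarrow> 'w \<Rightarrow> real" where
  "cond_prob_given M N X A = cond_expect_given M N X (indicator A)"

definition cond_indep_var ::
  "'w measure \<Rightarrow> 'x measure \<Rightarrow> ('w \<Rightarrow> 'x)
    \<Rightarrow> 'y measure \<Rightarrow> ('w \<Rightarrow> 'y) \<Rightarrow> 't measure \<Rightarrow> ('w \<Rightarrow> 't) \<Rightarrow> bool" where
  "cond_indep_var M N X K Y L T \<longleftrightarrow>
     (\<forall>A\<in>sets K. \<forall>B\<in>sets L. AE \<omega> in M.
        cond_prob_given M N X {\<omega> \<in> space M. Y \<omega> \<in> A \<and> T \<omega> \<in> B} \<omega>
        = cond_prob_given M N X {\<omega> \<in> space M. Y \<omega> \<in> A} \<omega>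
          * cond_prob_given M N X {\<omega> \<in> space M. T \<omega> \<in> B} \<omega>)"

definition covariance :: "'w measure \<Rightarrow> ('w \<Rightarrow> real) \<Rightarrow> ('w \<Rightarrow> real) \<Rightarrow> real" where
  "covariance M A B = (\<integral>\<omega>. A \<omega> * B \<omega> \<partial>M) - (\<integral>\<omega>. A \<omega> \<partial>M) * (\<integral>\<omega>. B \<omega> \<partial>M)"

end

theory Submission
  imports Defs
begin

text \<open>
  By the tower property \<open>\<mu>\<^sub>1 = E[\<mu>\<^sub>1(X)]\<close>, so with \<open>w = e(X) / e\<^sup>*(X)\<close> the right-hand side of
  the hypothesis is \<open>\<bar>cov[w, \<mu>\<^sub>1(X)]\<bar> / E[w]\<close>; overlap makes \<open>w\<close> bounded with \<open>E[w] > 0\<close>. The left-hand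
  side is \<open>\<bar>E[(w - 1) \<mu>\<^sub>1(X)] - E[(w - 1) \<mu>\<^sub>1\<^sup>*(X)]\<bar>\<close>, and the claim is
  \<open>\<bar>a - b\<bar> < c \<longleftrightarrow> a - c < b \<and> b < a + c\<close>.
\<close>

text \<open>The tower property over the whole space. Measurability of \<open>X\<close> makes the
  pulled-back sigma-algebra a subalgebra of \<open>M\<close>, and finiteness of the measure supplies
  the sigma-finiteness that \<open>real_cond_exp\<close> relies on.\<close>

lemma (in prob_space) cond_expect_given_integral:
  assumes X: "X \<in> M \<rightarrow>\<^sub>M N" and Y: "integrable M Y"
  shows "integrable M (cond_expect_given M N X Y)"
    and "(\<integral>\<omega>. cond_expect_given M N X Y \<omega> \<partial>M) = (\<integral>\<omega>. Y \<omega> \<partial>M)"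
proof -
  have "subalgebra M (sigma_gen M X N)"
    using X unfolding subalgebra_def sigma_gen_def
    by (auto simp: sets_vimage_algebra2[OF measurable_space[OF X, THEN funcsetI]] dest: measurable_sets)
  then interpret finite_measure_subalgebra M "sigma_gen M X N"
    by unfold_locales
  show "integrable M (cond_expect_given M N X Y)"
    and "(\<integral>\<omega>. cond_expect_given M N X Y \<omega> \<partial>M) = (\<integral>\<omega>. Y \<omega> \<partial>M)"
    unfolding cond_expect_given_def using real_cond_exp_int[OF Y] by auto
qed

text \<open>Strictness survives integration because the set where it holds has measure 1 and so is
  not null.\<close>

lemma (in prob_space) integral_pos:
  fixes w :: "'a \<Rightarrow> real"
  assumes "integrable M w" and "AE \<omega> in M. 0 < w \<omega>"
  shows "0 < (\<integral>\<omega>. w \<omega> \<partial>M)"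
  using integral_less_AE_space[of "\<lambda>_. 0" w] assms emeasure_space_1 by simp

text \<open>Domination by \<open>B * f\<close>. This serves products of the bounded weight with
  regressions that are only assumed integrable.\<close>

lemma integrable_bounded_mult:
  fixes w f :: "'a \<Rightarrow> real"
  assumes "integrable M f" and "w \<in> borel_measurable M" and "AE \<omega> in M. \<bar>w \<omega>\<bar> \<le> B"
  shows "integrable M (\<lambda>\<omega>. w \<omega> * f \<omega>)"
proof (rule Bochner_Integration.integrable_bound)
  show "integrable M (\<lambda>\<omega>. B * f \<omega>)"
    using assms(1) by simp
  show "AE \<omega> in M. norm (w \<omega> * f \<omega>) \<le> norm (B * f \<omega>)"
    using assms(3) by eventually_elim (auto simp: abs_mult intro!: mult_right_mono)
qed (use assms in measurable)

theorem theorem13: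
  fixes M :: "'w measure"
    and X :: "'w \<Rightarrow> real ^ 'd"
    and T :: "'w \<Rightarrow> nat"
    and Y1 :: "'w \<Rightarrow> real"
    and e e_star \<mu>1 \<mu>1_star :: "real ^ 'd \<Rightarrow> real"
    and \<eta> \<nu> :: real
  assumes "prob_space M"
    and "X \<in> M \<rightarrow>\<^sub>M borel"
    and "T \<in> M \<rightarrow>\<^sub>M count_space {0, 1}"
    and "integrable M Y1"
    and "cond_indep_var M borel X borel Y1 (count_space {0, 1}) T"
    and "e \<in> borel_measurable borel"
    and "AE \<omega> in M. e (X \<omega>) = cond_prob_given M borel X {\<omega> \<in> space M. T \<omega> = 1} \<omega>"
    and "\<eta> > 0" and "AE \<omega> in M. \<eta> < e (X \<omega>) \<and> e (X \<omega>) < 1 - \<eta>"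
    and "e_star \<in> borel_measurable borel"
    and "\<nu> > 0" and "AE \<omega> in M. \<nu> < e_star (X \<omega>) \<and> e_star (X \<omega>) < 1 - \<nu>"
    and "\<mu>1 \<in> borel_measurable borel"
    and "AE \<omega> in M. \<mu>1 (X \<omega>) = cond_expect_given M borel X Y1 \<omega>"
    and "\<mu>1_star \<in> borel_measurable borel"
    and "integrable M (\<lambda>\<omega>. \<mu>1_star (X \<omega>))"
    and "\<bar>\<integral>\<omega>. (e (X \<omega>) / e_star (X \<omega>) - 1) * (\<mu>1 (X \<omega>) - \<mu>1_star (X \<omega>)) \<partial>M\<bar>
         < \<bar>(\<integral>\<omega>. e (X \<omega>) / e_star (X \<omega>) * \<mu>1 (X \<omega>) \<partial>M)
              / (\<integral>\<omega>. e (X \<omega>) / e_star (X \<omega>) \<partial>M)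
            - (\<integral>\<omega>. Y1 \<omega> \<partial>M)\<bar>"
  shows "(\<integral>\<omega>. (e (X \<omega>) / e_star (X \<omega>) - 1) * \<mu>1 (X \<omega>) \<partial>M)
           - \<bar>covariance M (\<lambda>\<omega>. e (X \<omega>) / e_star (X \<omega>)) (\<lambda>\<omega>. \<mu>1 (X \<omega>))\<bar>
               / (\<integral>\<omega>. e (X \<omega>) / e_star (X \<omega>) \<partial>M)
         < (\<integral>\<omega>. (e (X \<omega>) / e_star (X \<omega>) - 1) * \<mu>1_star (X \<omega>) \<partial>M)
       \<and> (\<integral>\<omega>. (e (X \<omega>) / e_star (X \<omega>) - 1) * \<mu>1_star (X \<omega>) \<partial>M)
         < (\<integral>\<omega>. (e (X \<omega>) / e_star (X \<omega>) - 1) * \<mu>1 (X \<omega>) \<partial>M)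
           + \<bar>covariance M (\<lambda>\<omega>. e (X \<omega>) / e_star (X \<omega>)) (\<lambda>\<omega>. \<mu>1 (X \<omega>))\<bar>
               / (\<integral>\<omega>. e (X \<omega>) / e_star (X \<omega>) \<partial>M)"
proof -
  interpret prob_space M by fact
  have [measurable]: "X \<in> M \<rightarrow>\<^sub>M borel" "e \<in> borel_measurable borel"
    "e_star \<in> borel_measurable borel" "\<mu>1 \<in> borel_measurable borel"
    by fact+
  define w where "w \<omega> = e (X \<omega>) / e_star (X \<omega>)" for \<omega>
  define m where "m \<omega> = \<mu>1 (X \<omega>)" for \<omega>
  define m' where "m' \<omega> = \<mu>1_star (X \<omega>)" for \<omega>
  have w_meas [measurable]: "w \<in> borel_measurable M"
    unfolding w_def by measurable
  \<comment> \<open>The numerator lies between \<open>\<eta> > 0\<close> and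
    \<open>1 - \<eta> < 1\<close>, and the denominator exceeds \<open>\<nu> > 0\<close>.\<close>
  have w_bounds: "AE \<omega> in M. 0 < w \<omega> \<and> \<bar>w \<omega>\<bar> \<le> 1 / \<nu>"
    using assms(9,12)
  proof eventually_elim
    case (elim \<omega>)
    with \<open>\<eta> > 0\<close> \<open>\<nu> > 0\<close> show ?case
      unfolding w_def by (auto intro!: frac_le)
  qed
  then have w_bounded: "AE \<omega> in M. \<bar>w \<omega>\<bar> \<le> 1 / \<nu>" and w_pos: "AE \<omega> in M. 0 < w \<omega>"
    by auto
  have w_int: "integrable M w"
    using w_bounded by (intro integrable_const_bound) auto
  have Ew: "0 < (\<integral>\<omega>. w \<omega> \<partial>M)"
    using w_int w_pos by (rule integral_pos)
  note Y1 = cond_expect_given_integral[OF \<open>X \<in> M \<rightarrow>\<^sub>M borel\<close> \<open>integrable M Y1\<close>]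
  have m_AE: "AE \<omega> in M. cond_expect_given M borel X Y1 \<omega> = m \<omega>"
    using assms(14) unfolding m_def by eventually_elim simp
  have m_meas: "m \<in> borel_measurable M"
    unfolding m_def by measurable
  \<comment> \<open>\<open>m\<close> is a version of E(Y(1) | X), so it inherits integrability and,
    next, the mean of \<open>Y1\<close> through a.e. equality.\<close>
  have m_int: "integrable M m"
    using integrable_cong_AE_imp[OF Y1(1) m_meas] m_AE by (auto simp: eq_commute)
  have Em: "(\<integral>\<omega>. Y1 \<omega> \<partial>M) = (\<integral>\<omega>. m \<omega> \<partial>M)"
    using integral_cong_AE[OF borel_measurable_integrable[OF Y1(1)] m_meas m_AE] Y1(2) by simp
  have m'_int: "integrable M m'"
    unfolding m'_def by fact
  \<comment> \<open>Expanding \<open>(w - 1) * m\<close> as \<open>w * m - m\<close>, and likewise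
    for \<open>m'\<close>, these give the integrability that linearity needs below.\<close>
  have wm: "integrable M (\<lambda>\<omega>. w \<omega> * m \<omega>)" and wm': "integrable M (\<lambda>\<omega>. w \<omega> * m' \<omega>)"
    using integrable_bounded_mult[OF _ w_meas w_bounded] m_int m'_int by auto
  \<comment> \<open>With E[Y(1)] replaced by E[m], the common denominator E[w], nonzero by
    \<open>Ew\<close>, leaves E[wm] - E[w]E[m] on top.\<close>
  have "(\<integral>\<omega>. w \<omega> * m \<omega> \<partial>M) / (\<integral>\<omega>. w \<omega> \<partial>M) - (\<integral>\<omega>. Y1 \<omega> \<partial>M)
      = covariance M w m / (\<integral>\<omega>. w \<omega> \<partial>M)"
    using Ew unfolding covariance_def Em by (simp add: field_simps)
  moreover have "(\<integral>\<omega>. (w \<omega> - 1) * (m \<omega> - m' \<omega>) \<partial>M)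
      = (\<integral>\<omega>. (w \<omega> - 1) * m \<omega> \<partial>M) - (\<integral>\<omega>. (w \<omega> - 1) * m' \<omega> \<partial>M)"
    using wm wm' m_int m'_int
    by (subst Bochner_Integration.integral_diff[symmetric]) (auto simp: algebra_simps)
  moreover have "\<bar>\<integral>\<omega>. (w \<omega> - 1) * (m \<omega> - m' \<omega>) \<partial>M\<bar>
      < \<bar>(\<integral>\<omega>. w \<omega> * m \<omega> \<partial>M) / (\<integral>\<omega>. w \<omega> \<partial>M) - (\<integral>\<omega>. Y1 \<omega> \<partial>M)\<bar>"
    unfolding w_def m_def m'_def by fact
  \<comment> \<open>Since E[w] > 0, the absolute value of the quotient falls on the covariance
    alone.\<close>
  ultimately have "\<bar>(\<integral>\<omega>. (w \<omega> - 1) * m \<omega> \<partial>M) - (\<integral>\<omega>. (w \<omega> - 1) * m' \<omega> \<partial>M)\<bar>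
      < \<bar>covariance M w m\<bar> / (\<integral>\<omega>. w \<omega> \<partial>M)"
    using Ew by (simp add: abs_divide)
  then show ?thesis
    unfolding w_def [symmetric] m_def [symmetric] m'_def [symmetric] by (auto simp: abs_less_iff)
qed

end
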